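(* Let $S$ be a Polish space, $\mu\in P(S)$ and $\delta>0$. Suppose that $c:S\times S\to\mathbb{R}_+$ is nonnegative and lower semicontinuous with $c(x,y)=0$ if and only if $x=y$, and that $f:S\to\mathbb{R}$ is upper semicontinuous with $f\in L^1(d\mu)$. Let $(\lambda^*,\phi_{\lambda^*})\in\Lambda_{c,f}$ be a dual-optimal pair satisfying $I=J=J(\lambda^*,\phi_{\lambda^*})<\infty$. In addition, suppose that the following two properties hold. (P-Compactness) For any $\epsilon>0$ there exists a compact $K_\epsilon\subseteq S$ such that $\mu(K_\epsilon)>1-\epsilon$, and the closure $\mathrm{cl}(\Gamma_\epsilon)$ of the set $$\Gamma_\epsilon:=\{(x,y)\in K_\epsilon\times S:\ f(y)-\lambda^*c(x,y)\ge\phi_{\lambda^*}(x)-\gamma\}$$ is compact, for some $\gamma\in(0,\infty)$. (P-USC) For every collection $\{\pi_n:n\ge1\}\subseteq\Phi'_{\mu,\delta}$ such that $\pi_n\Rightarrow\pi^*$ (weak convergence) for some $\pi^*\in\Phi_{\mu,\delta}$, we have $\limsup_n I(\pi_n)\le I(\pi^* )$. Then there exists a primal optimizer $\pi^*\in\Phi_{\mu,\delta}$ satisfying $I(\pi^* )=I=J=J(\lambda^*,\phi_{\lambda^*})$.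
   Context: $P(S)$ is the set of Borel probability measures on $S$; $\Pi(\mu,\nu)$ is the set of Borel probability measures on $S\times S$ with marginals $\mu$ and $\nu$. $\mathcal{U}(S)$ is the universal $\sigma$-algebra of $S$, and $\mathfrak{m}_{\mathcal U}(S;\overline{\mathbb R})$ is the set of measurable functions $(S,\mathcal U(S))\to(\overline{\mathbb R},\mathcal B(\overline{\mathbb R}))$. Integrals of universally measurable functions are with respect to completions. $$\Phi_{\mu,\delta}:=\Big\{\pi\in\bigcup_{\nu\in P(S)}\Pi(\mu,\nu):\int c\,d\pi\le\delta\Big\},\quad I(\pi):=\int f(y)\,d\pi(x,y),\quad I:=\sup\{I(\pi):\pi\in\Phi_{\mu,\delta}\},$$ where by convention the supremum is only over $\pi$ with $\int f^-(y)\,d\pi(x,y)<\infty$, $f^-=\max(-f,0)$. $$\Phi'_{\mu,\delta}:=\{\pi\in\Phi_{\mu,\delta}:\pi(\{(x,y)\in S\times S:f(x)\le f(y)\})=1\}.$$ $$\Lambda_{c,f}:=\{(\lambda,\phi):\lambda\ge0,\ \phi\in\mathfrak{m}_{\mathcal U}(S;\overline{\mathbb R}),\ \phi(x)+\lambda c(x,y)\ge f(y)\ \forall x,y\in S\},$$ $$J(\lambda,\phi):=\lambda\delta+\int\phi\,d\mu,\quad J:=\inf\{J(\lambda,\phi):(\lambda,\phi)\in\Lambda_{c,f}\},\quad \phi_\lambda(x):=\sup_{y\in S}\{f(y)-\lambda c(x,y)\}.$$ *)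

theory Defs
  imports "HOL-Probability.Probability"
begin

definition lower_semicontinuous :: "('a::topological_space \<Rightarrow> real) \<Rightarrow> bool" where
  "lower_semicontinuous g \<longleftrightarrow> (\<forall>a. open {x. a < g x})"

definition upper_semicontinuous :: "('a::topological_space \<Rightarrow> real) \<Rightarrow> bool" where
  "upper_semicontinuous g \<longleftrightarrow> (\<forall>a. open {x. g x < a})"

definition borel_probs :: "'a::topological_space measure set" where
  "borel_probs = {M. prob_space M \<and> sets M = sets borel}"

definition couplings ::
  "'a::topological_space measure \<Rightarrow> 'a measure \<Rightarrow> ('a \<times> 'a) measure set" where
  "couplings \<mu> \<nu> = {\<pi> \<in> borel_probs. distr \<pi> borel fst = \<mu> \<and> distr \<pi> borel snd = \<nu>}"

definition universal_algebra :: "'a::topological_space measure" where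
  "universal_algebra = sigma UNIV (\<Inter>M\<in>borel_probs. sets (completion M))"

lemma sets_universal_algebra:
  "sets (universal_algebra :: 'a::topological_space measure) =
     (\<Inter>M\<in>borel_probs. sets (completion M))"
proof -
  let ?A = "\<Inter>M\<in>(borel_probs :: 'a measure set). sets (completion M)"
  have sp: "space (completion M) = UNIV" if "M \<in> borel_probs" for M :: "'a measure"
    using that sets_eq_imp_space_eq[of M borel] by (simp add: borel_probs_def)
  have "return borel x \<in> borel_probs" for x :: 'a
    by (simp add: borel_probs_def prob_space_return)
  then have ne: "(borel_probs :: 'a measure set) \<noteq> {}"
    by blast
  have "sigma_algebra UNIV ?A"
    unfolding sigma_algebra_iff2
  proof (intro conjI ballI allI impI)
    show "?A \<subseteq> Pow UNIV" by simp
    show "{} \<in> ?A" by simp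
    show "UNIV - s \<in> ?A" if "s \<in> ?A" for s
    proof
      fix M :: "'a measure"
      assume M: "M \<in> borel_probs"
      with that have "space (completion M) - s \<in> sets (completion M)"
        by (intro sets.compl_sets) blast
      with sp[OF M] show "UNIV - s \<in> sets (completion M)" by simp
    qed
    show "(\<Union>i. A i) \<in> ?A" if "range A \<subseteq> ?A" for A :: "nat \<Rightarrow> 'a set"
      using that by (intro INT_I sets.countable_UN) blast
  qed
  then show ?thesis
    by (simp add: universal_algebra_def sets_measure_of_conv sigma_algebra.sigma_sets_eq)
qed

text \<open>
  Integral of an extended real function with respect to the completion of \<open>M\<close>, as the
  difference of the integrals of its positive and negative parts (\<^const>\<open>e2ennreal\<close> maps
  negative values to \<open>0\<close>).  If both parts are infinite, the value is \<open>\<infinity> - \<infinity> = \<infinity>\<close> by the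
  convention for \<^typ>\<open>ereal\<close>; this never matters below: a dual feasible \<open>\<phi>\<close> dominates the
  integrable \<open>f\<close>, and a finite dual objective bounds the integral of the positive part of \<open>f y\<close>
  over all primal feasible measures.
\<close>
definition ext_integral :: "'a measure \<Rightarrow> ('a \<Rightarrow> ereal) \<Rightarrow> ereal" where
  "ext_integral M g =
     enn2ereal (\<integral>\<^sup>+ x. e2ennreal (g x) \<partial>completion M)
     - enn2ereal (\<integral>\<^sup>+ x. e2ennreal (- g x) \<partial>completion M)"

definition weakly_converges ::
  "(nat \<Rightarrow> 'a::topological_space measure) \<Rightarrow> 'a measure \<Rightarrow> bool" where
  "weakly_converges Ms M \<longleftrightarrow>
     (\<forall>g :: 'a \<Rightarrow> real. continuous_on UNIV g \<longrightarrow> bounded (range g) \<longrightarrow>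
        (\<lambda>n. integral\<^sup>L (Ms n) g) \<longlonglongrightarrow> integral\<^sup>L M g)"

definition primal_feasible ::
  "('a \<times> 'a \<Rightarrow> real) \<Rightarrow> 'a::topological_space measure \<Rightarrow> real \<Rightarrow> ('a \<times> 'a) measure set" where
  "primal_feasible c \<mu> \<delta> =
     {\<pi> \<in> (\<Union>\<nu>\<in>borel_probs. couplings \<mu> \<nu>). (\<integral>\<^sup>+ p. ennreal (c p) \<partial>\<pi>) \<le> ennreal \<delta>}"

definition primal_feasible' ::
  "('a \<times> 'a \<Rightarrow> real) \<Rightarrow> ('a \<Rightarrow> real) \<Rightarrow> 'a::topological_space measure \<Rightarrow> real
     \<Rightarrow> ('a \<times> 'a) measure set" where
  "primal_feasible' c f \<mu> \<delta> =
     {\<pi> \<in> primal_feasible c \<mu> \<delta>. emeasure \<pi> {(x, y). f x \<le> f y} = 1}"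

definition primal_obj :: "('a \<Rightarrow> real) \<Rightarrow> ('a \<times> 'a) measure \<Rightarrow> ereal" where
  "primal_obj f \<pi> = ext_integral \<pi> (\<lambda>(x, y). ereal (f y))"

definition primal_value ::
  "('a \<times> 'a \<Rightarrow> real) \<Rightarrow> ('a \<Rightarrow> real) \<Rightarrow> 'a::topological_space measure \<Rightarrow> real \<Rightarrow> ereal" where
  "primal_value c f \<mu> \<delta> =
     Sup (primal_obj f `
       {\<pi> \<in> primal_feasible c \<mu> \<delta>. (\<integral>\<^sup>+ (x, y). ennreal (max (- f y) 0) \<partial>\<pi>) < \<infinity>})"

definition dual_feasible ::
  "('a::topological_space \<times> 'a \<Rightarrow> real) \<Rightarrow> ('a \<Rightarrow> real) \<Rightarrow> (real \<times> ('a \<Rightarrow> ereal)) set" where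
  "dual_feasible c f =
     {(lam, \<phi>). 0 \<le> lam \<and> \<phi> \<in> borel_measurable universal_algebra \<and>
        (\<forall>x y. \<phi> x + ereal (lam * c (x, y)) \<ge> ereal (f y))}"

definition dual_obj :: "'a measure \<Rightarrow> real \<Rightarrow> real \<times> ('a \<Rightarrow> ereal) \<Rightarrow> ereal" where
  "dual_obj \<mu> \<delta> = (\<lambda>(lam, \<phi>). ereal (lam * \<delta>) + ext_integral \<mu> \<phi>)"

definition dual_value ::
  "('a \<times> 'a \<Rightarrow> real) \<Rightarrow> ('a \<Rightarrow> real) \<Rightarrow> 'a::topological_space measure \<Rightarrow> real \<Rightarrow> ereal" where
  "dual_value c f \<mu> \<delta> = Inf (dual_obj \<mu> \<delta> ` dual_feasible c f)"

definition dual_fun ::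
  "('a \<times> 'a \<Rightarrow> real) \<Rightarrow> ('a \<Rightarrow> real) \<Rightarrow> real \<Rightarrow> 'a \<Rightarrow> ereal" where
  "dual_fun c f lam x = (SUP y. ereal (f y - lam * c (x, y)))"

definition P_compactness ::
  "('a \<times> 'a \<Rightarrow> real) \<Rightarrow> ('a \<Rightarrow> real) \<Rightarrow> 'a::topological_space measure \<Rightarrow> real \<Rightarrow> bool" where
  "P_compactness c f \<mu> lam \<longleftrightarrow>
     (\<forall>\<epsilon>>0. \<exists>K. compact K \<and> measure \<mu> K > 1 - \<epsilon> \<and>
        (\<exists>\<gamma>>0. compact (closure
           {(x, y). x \<in> K \<and> ereal (f y - lam * c (x, y)) \<ge> dual_fun c f lam x - ereal \<gamma>})))"

definition P_usc ::
  "('a \<times> 'a \<Rightarrow> real) \<Rightarrow> ('a \<Rightarrow> real) \<Rightarrow> 'a::topological_space measure \<Rightarrow> real \<Rightarrow> bool" where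
  "P_usc c f \<mu> \<delta> \<longleftrightarrow>
     (\<forall>\<pi>s. \<forall>\<pi>\<in>primal_feasible c \<mu> \<delta>.
        (\<forall>n. \<pi>s n \<in> primal_feasible' c f \<mu> \<delta>) \<longrightarrow> weakly_converges \<pi>s \<pi> \<longrightarrow>
        limsup (\<lambda>n. primal_obj f (\<pi>s n)) \<le> primal_obj f \<pi>)"

end

theory Submission
  imports Defs
begin

text \<open>
  The proof is the direct method.  Let \<open>g\<close> be a real Borel version of the dual function; it exists because
  the dual function dominates the integrable \<open>f\<close> and has finite integral.  Under a feasible plan \<open>\<pi>\<close> the
  slack \<open>g x + lam * c (x, y) - f y\<close> is nonnegative almost surely, and its mean is at most the
  difference between the dual value and the objective of \<open>\<pi>\<close> (\<open>slack_integral\<close>).  As there is no duality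
  gap, the mean slack tends to zero along a maximizing sequence, and by Markov's inequality most of the
  mass lies where the slack is below \<open>\<gamma>\<close>.  Over a compact set of starting points that region is
  relatively compact by assumption, so the sequence is tight (\<open>tight_near_optimal\<close>).

  By Prokhorov's theorem (\<open>tight_imp_weakly_convergent_subsequence\<close>) a subsequence converges weakly, and
  the limit is feasible since the cost is lower semicontinuous and the first marginal is fixed
  (\<open>primal_feasible_weak_limit\<close>).  The upper semicontinuity condition passes the objective to the limit.
  It speaks of plans supported where \<open>f x \<le> f y\<close> only; every plan can be brought into this form without
  loss by undoing the transports that decrease \<open>f\<close> (\<open>maximizing_sequence\<close>).

  Prokhorov's theorem is reduced to Helly's selection theorem on the real line.  Points are coded by
  ternary expansions that record membership in a countable family of open sets.  The coding map need
  not be continuous, but limits of codes still determine the point (\<open>decodable_borel_code\<close>), so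
  decoding is continuous on the limits of codes coming from a compact set.
\<close>

section \<open>Lower semicontinuous functions and weak limits\<close>

text \<open>
  The largest \<open>k\<close>-Lipschitz function below \<open>min g k\<close>.  For lower semicontinuous \<open>g \<ge> 0\<close> these
  functions are bounded, continuous and converge to \<open>g\<close> from below, which reduces statements about
  weak limits and \<open>g\<close> to the bounded continuous test functions that define weak convergence.
\<close>

definition lipschitz_envelope :: "('b::metric_space \<Rightarrow> real) \<Rightarrow> nat \<Rightarrow> 'b \<Rightarrow> real" where
  "lipschitz_envelope g k p = (INF q. min (g q) (real k) + real k * dist p q)"

context
  fixes g :: "'b::metric_space \<Rightarrow> real"
  assumes g_nonneg: "\<And>x. 0 \<le> g x"
begin

lemma bdd_below_lipschitz_envelope: "bdd_below (range (\<lambda>q. min (g q) (real k) + real k * dist p q))"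
  using g_nonneg by (intro bdd_belowI[of _ 0]) auto

lemma lipschitz_envelope_le: "lipschitz_envelope g k p \<le> min (g q) (real k) + real k * dist p q"
  unfolding lipschitz_envelope_def by (rule cINF_lower[OF bdd_below_lipschitz_envelope]) simp

lemma lipschitz_envelope_bounds:
  "0 \<le> lipschitz_envelope g k p" "lipschitz_envelope g k p \<le> g p" "lipschitz_envelope g k p \<le> real k"
  using g_nonneg lipschitz_envelope_le[of k p p]
  by (auto simp: lipschitz_envelope_def intro!: cINF_greatest)

lemma lipschitz_envelope_diff:
  "lipschitz_envelope g k p \<le> lipschitz_envelope g k q + real k * dist p q"
proof -
  have "lipschitz_envelope g k p - real k * dist p q \<le> lipschitz_envelope g k q"
    unfolding lipschitz_envelope_def[of g k q]
  proof (rule cINF_greatest)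
    fix w
    have "real k * dist p w \<le> real k * (dist p q + dist q w)"
      by (intro mult_left_mono dist_triangle) simp
    then show "lipschitz_envelope g k p - real k * dist p q \<le> min (g w) (real k) + real k * dist q w"
      using lipschitz_envelope_le[of k p w] by (simp add: algebra_simps)
  qed simp
  then show ?thesis by simp
qed

lemma continuous_on_lipschitz_envelope: "continuous_on UNIV (lipschitz_envelope g k)"
proof -
  have "(real k)-lipschitz_on UNIV (lipschitz_envelope g k)"
  proof (rule lipschitz_onI)
    show "dist (lipschitz_envelope g k x) (lipschitz_envelope g k y) \<le> real k * dist x y" for x y
      using lipschitz_envelope_diff[of k x y] lipschitz_envelope_diff[of k y x]
      by (simp add: dist_real_def abs_le_iff dist_commute)
  qed simp
  then show ?thesis
    by (rule lipschitz_on_continuous_on)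
qed

text \<open>
  The infimum defining the envelope at \<open>p\<close> splits: close to \<open>p\<close> lower semicontinuity keeps \<open>g\<close>
  above any \<open>b < g p\<close>, and away from \<open>p\<close> the penalty \<open>k * dist p q\<close> is at least \<open>b\<close> once \<open>k\<close> is large.
\<close>

lemma lipschitz_envelope_tendsto:
  assumes "lower_semicontinuous g"
  shows "(\<lambda>k. lipschitz_envelope g k p) \<longlonglongrightarrow> g p"
proof (rule order_tendstoI)
  fix a assume "g p < a"
  then show "\<forall>\<^sub>F k in sequentially. lipschitz_envelope g k p < a"
    using lipschitz_envelope_bounds(2)[of _ p] by (auto intro: order.strict_trans1 always_eventually)
next
  fix a assume "a < g p"
  then obtain b where b: "a < b" "b < g p"
    using dense by blast
  have "open {x. b < g x}"
    using assms by (simp add: lower_semicontinuous_def)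
  then obtain r where r: "r > 0" "\<And>q. dist q p < r \<Longrightarrow> b < g q"
    using b(2) unfolding open_dist by blast
  have "\<forall>\<^sub>F k in sequentially. max b (b / r) \<le> real k"
    using filterlim_real_sequentially unfolding filterlim_at_top by blast
  then show "\<forall>\<^sub>F k in sequentially. a < lipschitz_envelope g k p"
  proof eventually_elim
    case (elim k)
    have "b \<le> lipschitz_envelope g k p"
      unfolding lipschitz_envelope_def
    proof (rule cINF_greatest)
      fix q
      show "b \<le> min (g q) (real k) + real k * dist p q"
      proof (cases "dist q p < r")
        case True
        then show ?thesis
          using r(2)[OF True] elim by (simp add: min_def add_increasing2)
      next
        case False
        have "b \<le> real k * r"
          using elim r(1) by (simp add: pos_divide_le_eq)
        also have "\<dots> \<le> real k * dist p q"
          using False by (intro mult_left_mono) (auto simp: dist_commute)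
        finally show ?thesis
          using g_nonneg[of q] by (simp add: min_def)
      qed
    qed simp
    with b(1) show ?case
      by (rule order.strict_trans2)
  qed
qed

end

lemma borel_measurable_lower_semicontinuous:
  "lower_semicontinuous g \<Longrightarrow> g \<in> borel_measurable borel"
  by (auto simp: lower_semicontinuous_def borel_measurable_iff_greater)

lemma borel_measurable_upper_semicontinuous:
  "upper_semicontinuous g \<Longrightarrow> g \<in> borel_measurable borel"
  by (auto simp: upper_semicontinuous_def borel_measurable_iff_less)

lemma borel_probsD:
  assumes "M \<in> borel_probs"
  shows "prob_space M" "sets M = sets borel" "space M = UNIV"
  using assms sets_eq_imp_space_eq[of M borel] by (auto simp: borel_probs_def)

text \<open>
  Each Lipschitz envelope of \<open>g\<close> is an admissible test function, so its integral inherits the bound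
  in the limit; Fatou's lemma then passes from the envelopes to \<open>g\<close>.  With \<open>g\<close> a cost this keeps the
  budget constraint in the limit, with \<open>g\<close> the indicator of an open set it is the portmanteau
  inequality below.
\<close>

lemma nn_integral_lsc_weak_limit_le:
  fixes g :: "'b::metric_space \<Rightarrow> real"
  assumes w: "weakly_converges Ms M" and Ms: "\<And>n. Ms n \<in> borel_probs" and M: "M \<in> borel_probs"
    and nonneg: "\<And>x. 0 \<le> g x" and lsc: "lower_semicontinuous g"
    and le: "\<forall>\<^sub>F n in sequentially. (\<integral>\<^sup>+x. ennreal (g x) \<partial>Ms n) \<le> ennreal B" and "0 \<le> B"
  shows "(\<integral>\<^sup>+x. ennreal (g x) \<partial>M) \<le> ennreal B"
proof -
  let ?g = "lipschitz_envelope g"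
  note bounds = lipschitz_envelope_bounds[of g, OF nonneg]
  have int: "integrable N (?g k)" "ennreal (integral\<^sup>L N (?g k)) = (\<integral>\<^sup>+x. ennreal (?g k x) \<partial>N)"
    if "N \<in> borel_probs" for N k
  proof -
    interpret prob_space N
      using borel_probsD(1)[OF that] .
    have "?g k \<in> borel_measurable N"
      using borel_measurable_continuous_onI[OF continuous_on_lipschitz_envelope[of g, OF nonneg]]
        borel_probsD(2)[OF that] by (simp add: measurable_def sets_eq_imp_space_eq[of N borel])
    then show "integrable N (?g k)"
      by (intro integrable_const_bound[of _ "real k"]) (use bounds in auto)
    then show "ennreal (integral\<^sup>L N (?g k)) = (\<integral>\<^sup>+x. ennreal (?g k x) \<partial>N)"
      using bounds by (intro nn_integral_eq_integral[symmetric]) auto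
  qed
  have step: "(\<integral>\<^sup>+x. ennreal (?g k x) \<partial>M) \<le> ennreal B" for k
  proof -
    have "bounded (range (?g k))"
      using bounds by (intro boundedI[of _ "real k"]) auto
    then have "(\<lambda>n. integral\<^sup>L (Ms n) (?g k)) \<longlonglongrightarrow> integral\<^sup>L M (?g k)"
      using w continuous_on_lipschitz_envelope[of g, OF nonneg] by (auto simp: weakly_converges_def)
    moreover have "\<forall>\<^sub>F n in sequentially. integral\<^sup>L (Ms n) (?g k) \<le> B"
      using le
    proof eventually_elim
      case (elim n)
      have "(\<integral>\<^sup>+x. ennreal (?g k x) \<partial>Ms n) \<le> (\<integral>\<^sup>+x. ennreal (g x) \<partial>Ms n)"
        using bounds by (intro nn_integral_mono ennreal_leI) auto
      with elim have "ennreal (integral\<^sup>L (Ms n) (?g k)) \<le> ennreal B"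
        using int(2)[OF Ms] by simp
      then show ?case
        using \<open>0 \<le> B\<close> by (simp add: ennreal_le_iff)
    qed
    ultimately have "integral\<^sup>L M (?g k) \<le> B"
      by (rule tendsto_upperbound) simp
    then show ?thesis
      unfolding int(2)[OF M, symmetric] by (rule ennreal_leI)
  qed
  have "(\<integral>\<^sup>+x. ennreal (g x) \<partial>M) = (\<integral>\<^sup>+x. liminf (\<lambda>k. ennreal (?g k x)) \<partial>M)"
    using lipschitz_envelope_tendsto[of g, OF nonneg lsc]
    by (intro nn_integral_cong lim_imp_Liminf[symmetric] tendsto_ennrealI) auto
  also have "\<dots> \<le> liminf (\<lambda>k. \<integral>\<^sup>+x. ennreal (?g k x) \<partial>M)"
    using int(1)[OF M] by (intro nn_integral_liminf) auto
  also have "\<dots> \<le> ennreal B"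
    using step by (intro Liminf_le) auto
  finally show ?thesis .
qed

lemma measure_open_weak_limit_le:
  fixes U :: "'b::metric_space set"
  assumes "weakly_converges Ms M" "\<And>n. Ms n \<in> borel_probs" "M \<in> borel_probs" "open U"
    and le: "\<forall>\<^sub>F n in sequentially. measure (Ms n) U \<le> B" and "0 \<le> B"
  shows "measure M U \<le> B"
proof -
  have ind: "(\<integral>\<^sup>+x. ennreal (indicator U x) \<partial>N) = ennreal (measure N U)" if "N \<in> borel_probs" for N
  proof -
    interpret prob_space N
      using borel_probsD(1)[OF that] .
    show ?thesis
      using \<open>open U\<close> borel_probsD(2)[OF that] by (simp add: ennreal_indicator emeasure_eq_measure)
  qed
  have "{x. a < (indicator U x :: real)} = (if a < 0 then UNIV else if a < 1 then U else {})" for a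
    by (auto simp: indicator_def)
  then have "lower_semicontinuous (indicator U)"
    using \<open>open U\<close> by (simp add: lower_semicontinuous_def)
  then have "(\<integral>\<^sup>+x. ennreal (indicator U x) \<partial>M) \<le> ennreal B"
    using le assms by (intro nn_integral_lsc_weak_limit_le[OF assms(1-3)]) (auto simp: ind ennreal_leI elim: eventually_mono)
  then show ?thesis
    using \<open>0 \<le> B\<close> assms(3) by (simp add: ind)
qed

text \<open>
  Under this hypothesis the constant sequence at \<open>M\<close> converges weakly to \<open>N\<close> and conversely, so the
  portmanteau inequality holds in both directions and \<open>M\<close>, \<open>N\<close> agree on open sets, an intersection-stable generator.
\<close>

lemma borel_probs_eqI:
  fixes M N :: "'b::metric_space measure"
  assumes M: "M \<in> borel_probs" and N: "N \<in> borel_probs"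
    and eq: "\<And>g :: 'b \<Rightarrow> real. continuous_on UNIV g \<Longrightarrow> bounded (range g) \<Longrightarrow> integral\<^sup>L M g = integral\<^sup>L N g"
  shows "M = N"
proof (rule measure_eqI_generator_eq[where E="{U. open U}" and \<Omega>=UNIV and A="\<lambda>_. UNIV"])
  have "weakly_converges (\<lambda>_. M) N" "weakly_converges (\<lambda>_. N) M"
    using eq by (auto simp: weakly_converges_def)
  then have "measure M U = measure N U" if "open U" for U
    using measure_open_weak_limit_le[of "\<lambda>_. M" N U "measure M U"]
      measure_open_weak_limit_le[of "\<lambda>_. N" M U "measure N U"] that M N by simp
  then show "emeasure M U = emeasure N U" if "U \<in> {U. open U}" for U
    using that borel_probsD(1)[OF M] borel_probsD(1)[OF N]
    by (simp add: finite_measure.emeasure_eq_measure prob_space_def)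
  show "emeasure M UNIV \<noteq> \<infinity>"
    using borel_probsD(1,3)[OF M] prob_space.emeasure_space_1[of M] by simp
  have "sets borel = sigma_sets UNIV {U :: 'b set. open U}"
    by (simp add: borel_def)
  then show "sets M = sigma_sets UNIV {U. open U}" "sets N = sigma_sets UNIV {U. open U}"
    using borel_probsD(2)[OF M] borel_probsD(2)[OF N] by simp_all
qed (auto simp: Int_stable_def)

section \<open>Coding a second-countable metric space by real numbers\<close>

definition ternary_code :: "(nat \<Rightarrow> bool) \<Rightarrow> real" where
  "ternary_code P = (\<Sum>i. (if P i then 2 else 0) / 3 ^ Suc i)"

lemma summable_ternary_code: "summable (\<lambda>i. (if P i then 2 else 0) / 3 ^ Suc i :: real)"
proof (rule summable_comparison_test)
  show "\<exists>N. \<forall>i\<ge>N. norm ((if P i then 2 else 0) / 3 ^ Suc i :: real) \<le> 2 / 3 * (1 / 3) ^ i"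
    by (auto simp: power_divide)
  show "summable (\<lambda>i. 2 / 3 * (1 / 3 :: real) ^ i)"
    by (intro summable_mult summable_geometric) simp
qed

text \<open>
  The self-similarity of the Cantor set, the source of the separation bound below.
\<close>

lemma ternary_code_shift:
  "ternary_code P = (if P 0 then 2 / 3 else 0) + ternary_code (\<lambda>i. P (Suc i)) / 3"
proof -
  have "ternary_code P = (\<Sum>i. (if P (Suc i) then 2 else 0) / 3 ^ Suc (Suc i)) + (if P 0 then 2 / 3 else 0)"
    unfolding ternary_code_def using suminf_split_head[OF summable_ternary_code[of P]] by simp
  also have "(\<Sum>i. (if P (Suc i) then 2 else 0) / 3 ^ Suc (Suc i)) = ternary_code (\<lambda>i. P (Suc i)) / (3 :: real)"
    unfolding ternary_code_def by (subst suminf_divide[OF summable_ternary_code, symmetric]) (simp add: mult.commute)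
  finally show ?thesis by simp
qed

lemma ternary_code_bounds: "0 \<le> ternary_code P" "ternary_code P \<le> 1"
proof -
  show "0 \<le> ternary_code P"
    unfolding ternary_code_def by (intro suminf_nonneg summable_ternary_code) simp
  have s: "(\<lambda>i. 2 / 3 * (1 / 3 :: real) ^ i) sums (2 / 3 * (1 / (1 - 1 / 3)))"
    by (intro sums_mult geometric_sums) simp
  have "ternary_code P \<le> (\<Sum>i. 2 / 3 * (1 / 3) ^ i)"
    unfolding ternary_code_def
    by (intro suminf_le summable_ternary_code sums_summable[OF s]) (simp add: power_divide)
  also have "\<dots> = 1"
    using sums_unique[OF s] by simp
  finally show "ternary_code P \<le> 1" .
qed

text \<open>
  The digit 1 is never used, so a difference in digit \<open>i\<close> leaves a gap that the remaining digits
  cannot fill.  Two sequences of codes with the same limit therefore agree eventually in each digit.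
\<close>

lemma ternary_code_separates:
  "P i \<noteq> Q i \<Longrightarrow> 1 / 3 ^ Suc i \<le> \<bar>ternary_code P - ternary_code Q\<bar>"
proof (induction i arbitrary: P Q)
  case 0
  then show ?case
    using ternary_code_bounds[of "\<lambda>i. P (Suc i)"] ternary_code_bounds[of "\<lambda>i. Q (Suc i)"]
    by (subst (1 2) ternary_code_shift) (auto split: if_splits)
next
  case (Suc i)
  show ?case
  proof (cases "P 0 = Q 0")
    case True
    have "1 / 3 ^ Suc i / 3 \<le> \<bar>ternary_code (\<lambda>i. P (Suc i)) - ternary_code (\<lambda>i. Q (Suc i))\<bar> / 3"
      using Suc.IH[of "\<lambda>i. P (Suc i)" "\<lambda>i. Q (Suc i)"] Suc.prems by (intro divide_right_mono) auto
    also have "\<dots> = \<bar>ternary_code P - ternary_code Q\<bar>"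
      using True ternary_code_shift[of P] ternary_code_shift[of Q] by (simp add: diff_divide_distrib[symmetric])
    finally show ?thesis by simp
  next
    case False
    have "1 / 3 ^ Suc (Suc i) \<le> (1 / 3 :: real)"
      using power_decreasing[of 1 "Suc (Suc i)" "1 / 3 :: real"] by (simp add: power_divide)
    also have "\<dots> \<le> \<bar>ternary_code P - ternary_code Q\<bar>"
      using False ternary_code_bounds[of "\<lambda>i. P (Suc i)"] ternary_code_bounds[of "\<lambda>i. Q (Suc i)"]
        ternary_code_shift[of P] ternary_code_shift[of Q]
      by (auto split: if_splits)
    finally show ?thesis .
  qed
qed

lemma countable_separating_opens:
  obtains U :: "nat \<Rightarrow> 'b::{metric_space,second_countable_topology} set"
  where "\<And>i. open (U i)" "\<And>x y. x \<noteq> y \<Longrightarrow> \<exists>i. x \<in> U i \<and> y \<notin> closure (U i)"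
proof -
  obtain B :: "'b set set" where B: "countable B" "topological_basis B"
    using ex_countable_basis by blast
  have *: "\<exists>A\<in>B. x \<in> A \<and> y \<notin> closure A" if "x \<noteq> y" for x y :: 'b
  proof -
    have "x \<in> ball x (dist x y / 2)"
      using that by simp
    then obtain A where A: "A \<in> B" "x \<in> A" "A \<subseteq> ball x (dist x y / 2)"
      using topological_basisE[OF B(2) open_ball] by blast
    have "closure A \<subseteq> cball x (dist x y / 2)"
      using A(3) by (intro closure_minimal) auto
    moreover have "y \<notin> cball x (dist x y / 2)"
      using that by simp
    ultimately show ?thesis
      using A by blast
  qed
  have "B \<noteq> {}"
    using topological_basisE[OF B(2) open_UNIV UNIV_I] by blast
  then have r: "range (from_nat_into B) = B"
    by (rule range_from_nat_into[OF _ B(1)])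
  show ?thesis
  proof
    show "open (from_nat_into B i)" for i
      using topological_basis_open[OF B(2)] r by auto
    show "\<exists>i. x \<in> from_nat_into B i \<and> y \<notin> closure (from_nat_into B i)" if ne: "x \<noteq> y" for x y
    proof -
      obtain A where "A \<in> B" "x \<in> A" "y \<notin> closure A"
        using *[OF ne] by blast
      moreover from this(1) obtain i where "A = from_nat_into B i"
        using r by auto
      ultimately show ?thesis
        by blast
    qed

  qed
qed

text \<open>
  The code records membership in countably many separating open sets \<open>U i\<close>.  It need not be
  continuous, and decoding is possible only in the following sense: although a limit \<open>t\<close> of codes need not be the
  code of the limit point, it still determines that point.  If \<open>x \<noteq> y\<close> then some \<open>U i\<close> contains \<open>x\<close> and
  keeps \<open>y\<close> outside its closure, so points near \<open>x\<close> and points near \<open>y\<close> have different \<open>i\<close>-th digits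
  and their codes cannot approach the same \<open>t\<close>.  Thus the closure of the graph, read as a relation
  from codes to points, is single-valued.
\<close>

lemma decodable_borel_code:
  obtains s :: "'b::{metric_space,second_countable_topology} \<Rightarrow> real"
  where "s \<in> borel_measurable borel" "\<And>x. s x \<in> {0..1}"
    "\<And>t x y. (t, x) \<in> closure (range (\<lambda>z. (s z, z))) \<Longrightarrow> (t, y) \<in> closure (range (\<lambda>z. (s z, z))) \<Longrightarrow> x = y"
proof -
  obtain U :: "nat \<Rightarrow> 'b set" where U: "\<And>i. open (U i)"
    and sep: "\<And>x y. x \<noteq> y \<Longrightarrow> \<exists>i. x \<in> U i \<and> y \<notin> closure (U i)"
    using countable_separating_opens by blast
  define s where "s x = ternary_code (\<lambda>i. x \<in> U i)" for x
  have [measurable]: "U i \<in> sets borel" for i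
    using U by simp
  have "s \<in> borel_measurable borel"
    unfolding s_def ternary_code_def by measurable
  moreover have "s x \<in> {0..1}" for x
    using ternary_code_bounds by (simp add: s_def)
  moreover have "x = y"
    if x: "(t, x) \<in> closure (range (\<lambda>z. (s z, z)))" and y: "(t, y) \<in> closure (range (\<lambda>z. (s z, z)))" for t x y
  proof (rule ccontr)
    assume "x \<noteq> y"
    then obtain i where i: "x \<in> U i" "y \<notin> closure (U i)"
      using sep by blast
    \<comment> \<open>half of the gap between codes that differ in digit \<open>i\<close>\<close>
    define e :: real where "e = 1 / 3 ^ Suc i / 2"
    have e: "e > 0"
      by (simp add: e_def)
    have near: "\<exists>z\<in>V. dist (s z) t < e"
      if "(t, w) \<in> closure (range (\<lambda>z. (s z, z)))" "open V" "w \<in> V" for w V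
    proof -
      have "open (ball t e \<times> V)" "(t, w) \<in> ball t e \<times> V"
        using that e by (auto intro: open_Times)
      then have "(ball t e \<times> V) \<inter> range (\<lambda>z. (s z, z)) \<noteq> {}"
        using that(1) open_Int_closure_eq_empty[of "ball t e \<times> V" "range (\<lambda>z. (s z, z))"] by blast
      then show ?thesis
        by (auto simp: dist_commute)
    qed
    obtain z where z: "z \<in> U i" "dist (s z) t < e"
      using near[OF x U i(1)] by blast
    obtain w where w: "w \<notin> closure (U i)" "dist (s w) t < e"
      using near[OF y, of "- closure (U i)"] i(2) by auto
    have "w \<notin> U i"
      using w(1) closure_subset by blast
    then have "2 * e \<le> dist (s z) (s w)"
      using ternary_code_separates[of "\<lambda>i. z \<in> U i" i "\<lambda>i. w \<in> U i"] z(1) by (simp add: e_def s_def dist_real_def)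
    then show False
      using z(2) w(2) dist_triangle2[of "s z" "s w" t] by simp
  qed
  ultimately show ?thesis
    using that by blast
qed

text \<open>
  The preimage of a closed set under \<open>h\<close> is the projection of a closed subset of the compact
  graph, hence compact.
\<close>

lemma continuous_on_decoder:
  fixes G :: "('a::metric_space \<times> 'b::metric_space) set"
  assumes "compact G" and h: "\<And>t x. (t, x) \<in> G \<Longrightarrow> h t = x"
  shows "continuous_on (fst ` G) h"
  unfolding continuous_on_closed_invariant
proof safe
  fix B :: "'b set"
  assume "closed B"
  then have "compact (G \<inter> UNIV \<times> B)"
    by (intro compact_Int_closed assms(1) closed_Times) auto
  then have "compact (fst ` (G \<inter> UNIV \<times> B))"
    by (intro compact_continuous_image continuous_on_fst continuous_on_id)
  moreover have "fst ` (G \<inter> UNIV \<times> B) \<inter> fst ` G = h -` B \<inter> fst ` G"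
  proof (rule set_eqI)
    fix t
    have "t \<in> fst ` (G \<inter> UNIV \<times> B) \<longleftrightarrow> (\<exists>x. (t, x) \<in> G \<and> x \<in> B)" "t \<in> fst ` G \<longleftrightarrow> (\<exists>x. (t, x) \<in> G)"
      by (auto simp: image_iff Bex_def)
    then show "t \<in> fst ` (G \<inter> UNIV \<times> B) \<inter> fst ` G \<longleftrightarrow> t \<in> h -` B \<inter> fst ` G"
      using h by auto
  qed
  ultimately show "\<exists>A. closed A \<and> A \<inter> fst ` G = h -` B \<inter> fst ` G"
    using compact_imp_closed by blast
qed

section \<open>Prokhorov's theorem\<close>

lemma (in prob_space) abs_integral_diff_le_of_eq_on:
  fixes u v :: "'a \<Rightarrow> real"
  assumes [measurable]: "u \<in> borel_measurable M" "v \<in> borel_measurable M" "A \<in> sets M"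
    and bound: "\<And>x. \<bar>u x\<bar> \<le> b" "\<And>x. \<bar>v x\<bar> \<le> b"
    and eq: "\<And>x. x \<in> A \<Longrightarrow> u x = v x" and prob: "1 - \<epsilon> \<le> prob A"
  shows "\<bar>integral\<^sup>L M u - integral\<^sup>L M v\<bar> \<le> 2 * b * \<epsilon>"
proof -
  have int: "integrable M u" "integrable M v"
    using bound by (auto intro!: integrable_const_bound[of _ b])
  have "0 \<le> b"
    using bound(1)[of undefined] by linarith
  have "\<bar>integral\<^sup>L M u - integral\<^sup>L M v\<bar> = \<bar>\<integral>x. u x - v x \<partial>M\<bar>"
    using int by simp
  also have "\<dots> \<le> (\<integral>x. \<bar>u x - v x\<bar> \<partial>M)"
    by (rule integral_abs_bound)
  also have "\<dots> \<le> (\<integral>x. 2 * b * indicator (space M - A) x \<partial>M)"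
  proof (rule integral_mono)
    show "integrable M (\<lambda>x. 2 * b * indicator (space M - A) x)"
      by (intro integrable_mult_right integrable_real_indicator) (auto simp: emeasure_eq_measure)
    show "\<bar>u x - v x\<bar> \<le> 2 * b * indicator (space M - A) x" if "x \<in> space M" for x
      using bound[of x] eq[of x] that by (auto simp: indicator_def)
  qed (use int in auto)
  also have "\<dots> = 2 * b * prob (space M - A)"
    by simp
  also have "\<dots> \<le> 2 * b * \<epsilon>"
    using prob \<open>0 \<le> b\<close> by (intro mult_left_mono) (auto simp: prob_compl)
  finally show ?thesis .
qed

text \<open>
  The half of Prokhorov's theorem that extracts limits.  The measures are carried to the unit
  interval by the code \<open>s\<close>, where Helly's selection theorem provides a limit \<open>Q'\<close>, and \<open>Q'\<close> is carried
  back by the decoder \<open>h\<close>.  Over a compact set \<open>K m\<close> the closure of the graph of \<open>s\<close> is compact, so \<open>h\<close>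
  is continuous on the set \<open>C m\<close> of the codes that occur there.  By tightness all but a mass of
  \<open>1 / (m + 1)\<close> eventually lies on these sets: a bounded continuous \<open>g\<close> may be replaced by a continuous extension of \<open>g \<circ> h\<close>
  from the closed set \<open>C m\<close> to the line, for which convergence on the line applies.
\<close>

theorem tight_imp_weakly_convergent_subsequence:
  fixes M :: "nat \<Rightarrow> 'b::{metric_space,second_countable_topology} measure"
  assumes M: "\<And>n. M n \<in> borel_probs"
    and tight: "\<And>\<epsilon>. 0 < \<epsilon> \<Longrightarrow> \<exists>K. compact K \<and> (\<forall>\<^sub>F n in sequentially. 1 - \<epsilon> \<le> measure (M n) K)"
  obtains r N where "strict_mono r" "N \<in> borel_probs" "weakly_converges (M \<circ> r) N"
proof -
  note [measurable_cong] = borel_probsD(2)[OF M]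
  obtain s :: "'b \<Rightarrow> real" where s [measurable]: "s \<in> borel_measurable borel" and s01: "\<And>x. s x \<in> {0..1}"
    and decode: "\<And>t x y. (t, x) \<in> closure (range (\<lambda>z. (s z, z))) \<Longrightarrow> (t, y) \<in> closure (range (\<lambda>z. (s z, z))) \<Longrightarrow> x = y"
    using decodable_borel_code by blast
  define R where "R = closure (range (\<lambda>z. (s z, z)))"
  have sR: "(s x, x) \<in> R" for x
    using closure_subset[of "range (\<lambda>z. (s z, z))"] by (auto simp: R_def)
  have "\<forall>m. \<exists>K. compact K \<and> (\<forall>\<^sub>F n in sequentially. 1 - 1 / real (Suc m) \<le> measure (M n) K)"
    using tight by simp
  then obtain K where K: "\<And>m. compact (K m)"
    and K_mass: "\<And>m. \<forall>\<^sub>F n in sequentially. 1 - 1 / real (Suc m) \<le> measure (M n) (K m)"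
    by metis
  \<comment> \<open>The interval cuts the graph down to a compact set; \<open>C m\<close> is the set of limits of codes of
    points of \<open>K m\<close>, possibly larger than the image of \<open>K m\<close> under \<open>s\<close>.\<close>
  define G where "G m = R \<inter> {0..1} \<times> K m" for m
  define C where "C m = fst ` G m" for m
  define h where "h t = (if t \<in> (\<Union>m. C m) then SOME x. (t, x) \<in> R else undefined)" for t
  have G: "compact (G m)" for m
    unfolding G_def R_def by (intro closed_Int_compact compact_Times K compact_Icc) simp
  have hG: "h t = x" if "(t, x) \<in> G m" for t x m
  proof -
    have "(t, x) \<in> R" "t \<in> (\<Union>m. C m)"
      using that by (force simp: G_def C_def)+
    then show ?thesis
      using decode by (auto simp: h_def R_def intro!: some_equality)
  qed
  have sG: "(s x, x) \<in> G m" if "x \<in> K m" for x m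
    using that sR s01 by (auto simp: G_def)
  have sC: "s x \<in> C m" if "x \<in> K m" for x m
    using sG[OF that] by (force simp: C_def)
  have h_cont: "continuous_on (C m) h" for m
    unfolding C_def by (rule continuous_on_decoder[OF G hG])
  have C_closed: "closed (C m)" for m
    unfolding C_def by (intro compact_imp_closed compact_continuous_image G continuous_on_fst continuous_on_id)
  have [measurable]: "K m \<in> sets borel" "C m \<in> sets borel" for m
    using K C_closed by (simp_all add: borel_compact borel_closed)
  have h [measurable]: "h \<in> borel_measurable borel"
  proof (rule measurable_piecewise_restrict)
    let ?P = "insert (- (\<Union>m. C m)) (range C)"
    show "countable ?P" by simp
    show "space borel \<subseteq> \<Union> ?P" by auto
    show "A \<inter> space borel \<in> sets borel" if "A \<in> ?P" for A
      using that C_closed by auto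
    show "h \<in> borel_measurable (restrict_space borel A)" if "A \<in> ?P" for A
    proof (rule borel_measurable_continuous_on_restrict)
      have "continuous_on (- (\<Union>m. C m)) h"
        using continuous_on_const[of _ undefined] by (rule continuous_on_eq) (simp add: h_def)
      then show "continuous_on A h"
        using that h_cont by auto
    qed
  qed
  define Q where "Q n = distr (M n) borel s" for n
  have prob_M: "prob_space (M n)" for n
    using borel_probsD(1)[OF M] .
  have Q: "real_distribution (Q n)" for n
    unfolding Q_def by (rule prob_space.real_distribution_distr[OF prob_M]) measurable
  have "Helly_Selection.tight Q"
    unfolding tight_def
  proof (intro conjI allI impI Q)
    fix \<epsilon> :: real
    assume "0 < \<epsilon>"
    have "measure (Q n) {-1<..1} = 1" for n
    proof -
      have "-1 < s x \<and> s x \<le> 1" for x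
        using s01[of x] by simp
      then have "s -` {-1<..1} = UNIV"
        by auto
      then show ?thesis
        using prob_space.prob_space[OF prob_M[of n]] borel_probsD(3)[OF M[of n]] by (simp add: Q_def measure_distr)
    qed
    then show "\<exists>a b. a < b \<and> (\<forall>n. measure (Q n) {a<..b} > 1 - \<epsilon>)"
      using \<open>0 < \<epsilon>\<close> by (intro exI[of _ "-1"] exI[of _ 1]) simp
  qed
  then obtain r Q' where r: "strict_mono (r :: nat \<Rightarrow> nat)" and Q': "real_distribution Q'"
    and conv: "weak_conv_m (Q \<circ> id \<circ> r) Q'"
    using tight_imp_convergent_subsubsequence[OF _ strict_mono_id] by blast
  interpret Q': real_distribution Q' by fact
  have Q'_conv: "weakly_converges (\<lambda>n. Q (r n)) Q'"
    unfolding weakly_converges_def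
  proof (intro allI impI)
    fix F :: "real \<Rightarrow> real"
    assume F: "continuous_on UNIV F" "bounded (range F)"
    obtain b where "\<And>x. norm (F x) \<le> b"
      using F(2) by (auto simp: bounded_iff)
    then show "(\<lambda>n. integral\<^sup>L (Q (r n)) F) \<longlonglongrightarrow> integral\<^sup>L Q' F"
      using weak_conv_imp_integral_bdd_continuous_conv[of "\<lambda>n. Q (r n)" Q' F b] F(1) Q Q' conv
      by (simp add: comp_def continuous_on_eq_continuous_at)
  qed
  have K_mass_r: "\<forall>\<^sub>F n in sequentially. 1 - 1 / real (Suc m) \<le> measure (M (r n)) (K m)" for m
    using K_mass by (rule eventually_subseq[OF r])
  have Q'_C: "1 - 1 / real (Suc m) \<le> measure Q' (C m)" for m
  proof -
    have "measure Q' (- C m) \<le> 1 / real (Suc m)"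
    proof (rule measure_open_weak_limit_le[OF Q'_conv])
      show "Q (r n) \<in> borel_probs" for n
        using Q[of "r n"] by (simp add: borel_probs_def Q_def real_distribution_def)
      show "Q' \<in> borel_probs"
        by (simp add: borel_probs_def Q'.prob_space_axioms)
      show "open (- C m)"
        using C_closed by (rule open_Compl)
      show "\<forall>\<^sub>F n in sequentially. measure (Q (r n)) (- C m) \<le> 1 / real (Suc m)"
        using K_mass_r[of m]
      proof eventually_elim
        case (elim n)
        interpret prob_space "M (r n)" by (rule prob_M)
        have "measure (Q (r n)) (- C m) = prob (s -` (- C m))"
          using borel_probsD(3)[OF M[of "r n"]] by (simp add: Q_def measure_distr)
        also have "\<dots> \<le> prob (space (M (r n)) - K m)"
          using sC borel_probsD(3)[OF M[of "r n"]] by (intro finite_measure_mono) auto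
        also have "\<dots> \<le> 1 / real (Suc m)"
          using elim by (simp add: prob_compl)
        finally show ?case .
      qed
    qed simp
    then show ?thesis
      using Q'.prob_compl[of "C m"] C_closed[of m] by (simp add: Compl_eq_Diff_UNIV)
  qed
  define N where "N = distr Q' borel h"
  have N: "N \<in> borel_probs"
    unfolding N_def borel_probs_def by (auto intro!: Q'.prob_space_distr)
  have "(\<lambda>n. integral\<^sup>L (M (r n)) g) \<longlonglongrightarrow> integral\<^sup>L N g"
    if g: "continuous_on UNIV g" "bounded (range g)" for g :: "'b \<Rightarrow> real"
  proof -
    have [measurable]: "g \<in> borel_measurable borel"
      using g(1) by (rule borel_measurable_continuous_onI)
    obtain b where b: "0 < b" "\<And>x. \<bar>g x\<bar> \<le> b"
      using g(2) by (auto simp: bounded_pos)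
    have N_int: "integral\<^sup>L N g = (\<integral>t. g (h t) \<partial>Q')"
      by (simp add: N_def integral_distr)
    \<comment> \<open>Two replacements of \<open>g\<close> by the extension \<open>F\<close>, under \<open>M (r n)\<close> and under \<open>Q'\<close>, cost
      \<open>2 * b / (m + 1)\<close> each; the last \<open>b / (m + 1)\<close> is for convergence on the line.\<close>
    have close: "\<forall>\<^sub>F n in sequentially. \<bar>integral\<^sup>L (M (r n)) g - integral\<^sup>L N g\<bar> < 5 * b / real (Suc m)" for m
    proof -
      have "continuous_on (C m) (\<lambda>t. g (h t))"
        by (rule continuous_on_compose2[OF g(1) h_cont]) simp
      then obtain F where F: "continuous_on UNIV F" "\<And>t. t \<in> C m \<Longrightarrow> F t = g (h t)" "\<And>t. \<bar>F t\<bar> \<le> b"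
        using Tietze[of "C m" "\<lambda>t. g (h t)" UNIV b] C_closed[of m] b by auto
      have [measurable]: "F \<in> borel_measurable borel"
        using F(1) by (rule borel_measurable_continuous_onI)
      have 1: "\<bar>integral\<^sup>L Q' F - integral\<^sup>L N g\<bar> \<le> 2 * b * (1 / real (Suc m))"
        unfolding N_int using F b Q'_C by (intro Q'.abs_integral_diff_le_of_eq_on[of _ _ "C m"]) auto
      have "bounded (range F)"
        using F(3) by (auto simp: bounded_iff)
      then have "(\<lambda>n. integral\<^sup>L (Q (r n)) F) \<longlonglongrightarrow> integral\<^sup>L Q' F"
        using Q'_conv F(1) by (simp add: weakly_converges_def)
      then have "\<forall>\<^sub>F n in sequentially. \<bar>integral\<^sup>L (Q (r n)) F - integral\<^sup>L Q' F\<bar> < b / real (Suc m)"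
        unfolding dist_real_def[symmetric] by (rule tendstoD) (use b(1) in simp)
      then show ?thesis
        using K_mass_r[of m]
      proof eventually_elim
        case (elim n)
        interpret prob_space "M (r n)" by (rule prob_M)
        have "\<bar>integral\<^sup>L (M (r n)) g - (\<integral>x. F (s x) \<partial>M (r n))\<bar> \<le> 2 * b * (1 / real (Suc m))"
        proof (rule abs_integral_diff_le_of_eq_on[of _ _ "K m"])
          show "g x = F (s x)" if "x \<in> K m" for x
            using F(2)[OF sC[OF that]] hG[OF sG[OF that]] by simp
        qed (use F(3) b elim in auto)
        moreover have "(\<integral>x. F (s x) \<partial>M (r n)) = integral\<^sup>L (Q (r n)) F"
          by (simp add: Q_def integral_distr)
        ultimately show ?case
          using elim(1) 1 by (simp add: field_simps abs_le_iff abs_less_iff)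
      qed
    qed
    show ?thesis
    proof (rule tendstoI)
      fix e :: real
      assume "0 < e"
      then obtain m where "5 * b / e < real (Suc m)"
        using reals_Archimedean2 less_trans[of _ _ "real (Suc _)"] by (metis lessI of_nat_less_iff)
      then have "5 * b / real (Suc m) < e"
        using \<open>0 < e\<close> by (simp add: field_simps)
      then show "\<forall>\<^sub>F n in sequentially. dist (integral\<^sup>L (M (r n)) g) (integral\<^sup>L N g) < e"
        using close[of m] by (auto simp: dist_real_def elim!: eventually_mono)
    qed
  qed
  then have "weakly_converges (M \<circ> r) N"
    by (simp add: weakly_converges_def)
  then show ?thesis
    using that r N by blast
qed

section \<open>Integrals of extended real functions\<close>

lemma ext_integral_cong_AE:
  assumes "AE x in M. g x = h x"
  shows "ext_integral M g = ext_integral M h"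
proof -
  have "(\<integral>\<^sup>+x. e2ennreal (g x) \<partial>M) = (\<integral>\<^sup>+x. e2ennreal (h x) \<partial>M)"
    "(\<integral>\<^sup>+x. e2ennreal (- g x) \<partial>M) = (\<integral>\<^sup>+x. e2ennreal (- h x) \<partial>M)"
    using assms by (auto intro!: nn_integral_cong_AE)
  then show ?thesis
    by (simp add: ext_integral_def nn_integral_completion)
qed

lemma ext_integral_ereal:
  assumes "integrable M g"
  shows "ext_integral M (\<lambda>x. ereal (g x)) = ereal (integral\<^sup>L M g)"
proof -
  have "(\<integral>\<^sup>+x. ennreal (g x) \<partial>M) \<noteq> \<infinity>" "(\<integral>\<^sup>+x. ennreal (- g x) \<partial>M) \<noteq> \<infinity>"
    using assms by (auto simp: real_integrable_def)
  then show ?thesis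
    by (cases "\<integral>\<^sup>+x. ennreal (g x) \<partial>M"; cases "\<integral>\<^sup>+x. ennreal (- g x) \<partial>M")
      (auto simp: ext_integral_def nn_integral_completion real_lebesgue_integral_def[OF assms])
qed

text \<open>
  The lower bound by an integrable function makes the negative part of \<open>\<phi>\<close> integrable, the bound
  on the value then does the same for the positive part; so \<open>\<phi>\<close> is finite almost everywhere and can be
  changed on a null set to a real Borel function.  This removes extended reals and completions from
  the rest of the argument.
\<close>

lemma borel_version_of_universally_measurable:
  assumes \<mu>: "\<mu> \<in> borel_probs" and \<phi>: "\<phi> \<in> borel_measurable universal_algebra"
    and f: "integrable \<mu> f" "\<And>x. ereal (f x) \<le> \<phi> x" and fin: "ext_integral \<mu> \<phi> < \<infinity>"
  obtains g where "integrable \<mu> g" "AE x in \<mu>. \<phi> x = ereal (g x)"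
proof -
  let ?\<mu> = "completion \<mu>"
  have "sets (universal_algebra :: 'a measure) \<subseteq> sets ?\<mu>"
    using \<mu> by (auto simp: sets_universal_algebra)
  then have \<phi>_m [measurable]: "\<phi> \<in> borel_measurable ?\<mu>"
    using \<phi> borel_probsD(3)[OF \<mu>] by (auto simp: measurable_def universal_algebra_def)
  have "(\<integral>\<^sup>+x. e2ennreal (- \<phi> x) \<partial>\<mu>) \<le> (\<integral>\<^sup>+x. ennreal (- f x) \<partial>\<mu>)"
  proof (rule nn_integral_mono)
    fix x
    have "e2ennreal (- \<phi> x) \<le> e2ennreal (ereal (- f x))"
      using f(2)[of x] by (intro e2ennreal_mono) (simp flip: uminus_ereal.simps(1))
    then show "e2ennreal (- \<phi> x) \<le> ennreal (- f x)"
      by simp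
  qed
  also have "\<dots> < \<infinity>"
    using f(1) by (auto simp: real_integrable_def less_top)
  finally have neg: "(\<integral>\<^sup>+x. e2ennreal (- \<phi> x) \<partial>\<mu>) < \<infinity>" .
  have pos: "(\<integral>\<^sup>+x. e2ennreal (\<phi> x) \<partial>\<mu>) \<noteq> \<infinity>"
  proof
    assume "(\<integral>\<^sup>+x. e2ennreal (\<phi> x) \<partial>\<mu>) = \<infinity>"
    then have "ext_integral \<mu> \<phi> = \<infinity>"
      by (simp add: ext_integral_def nn_integral_completion)
    then show False
      using fin by simp
  qed
  have "AE x in ?\<mu>. e2ennreal (\<phi> x) \<noteq> \<infinity>"
    by (rule nn_integral_PInf_AE) (use pos in \<open>simp_all add: nn_integral_completion\<close>)
  then have real: "AE x in \<mu>. \<phi> x = ereal (real_of_ereal (\<phi> x))"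
    unfolding AE_completion_iff
  proof eventually_elim
    case (elim x)
    then show ?case
      using f(2)[of x] by (cases "\<phi> x") auto
  qed
  have "(\<lambda>x. real_of_ereal (\<phi> x)) \<in> borel_measurable ?\<mu>"
    by measurable
  then obtain g where g [measurable]: "g \<in> borel_measurable \<mu>" and eq: "AE x in \<mu>. real_of_ereal (\<phi> x) = g x"
    using completion_ex_borel_measurable_real by blast
  have \<phi>g: "AE x in \<mu>. \<phi> x = ereal (g x)"
    using real eq by eventually_elim simp
  have "(\<integral>\<^sup>+x. ennreal (g x) \<partial>\<mu>) = (\<integral>\<^sup>+x. e2ennreal (\<phi> x) \<partial>\<mu>)"
    "(\<integral>\<^sup>+x. ennreal (- g x) \<partial>\<mu>) = (\<integral>\<^sup>+x. e2ennreal (- \<phi> x) \<partial>\<mu>)"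
    using \<phi>g by (auto intro!: nn_integral_cong_AE)
  then have "integrable \<mu> g"
    using pos neg by (simp add: real_integrable_def)
  then show ?thesis
    using that \<phi>g by blast
qed

section \<open>Feasible plans and weak duality\<close>

lemma primal_feasible_iff:
  fixes \<mu> :: "'a::{metric_space,second_countable_topology} measure"
  shows "\<pi> \<in> primal_feasible c \<mu> \<delta> \<longleftrightarrow>
    \<pi> \<in> borel_probs \<and> distr \<pi> borel fst = \<mu> \<and> (\<integral>\<^sup>+p. ennreal (c p) \<partial>\<pi>) \<le> ennreal \<delta>"
proof -
  have "distr \<pi> borel snd \<in> borel_probs" if "\<pi> \<in> borel_probs"
  proof -
    have "snd \<in> borel_measurable \<pi>"
      using borel_probsD(2)[OF that] by (simp cong: measurable_cong_sets add: borel_measurable_continuous_onI continuous_on_snd)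
    then show ?thesis
      using prob_space.prob_space_distr[OF borel_probsD(1)[OF that]] by (auto simp: borel_probs_def)
  qed
  then show ?thesis
    by (auto simp: primal_feasible_def couplings_def)
qed

text \<open>
  The budget survives because \<open>c\<close> is lower semicontinuous, the first marginal because functions of
  the first coordinate are test functions and have the same integral along the whole sequence.
\<close>

lemma primal_feasible_weak_limit:
  fixes \<mu> :: "'a::{metric_space,second_countable_topology} measure"
  assumes conv: "weakly_converges \<pi>s \<pi>" and \<pi>: "\<pi> \<in> borel_probs"
    and \<pi>s: "\<And>n. \<pi>s n \<in> primal_feasible c \<mu> \<delta>" and \<mu>: "\<mu> \<in> borel_probs"
    and c: "\<And>p. 0 \<le> c p" "lower_semicontinuous c" and "0 \<le> \<delta>"
  shows "\<pi> \<in> primal_feasible c \<mu> \<delta>"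
  unfolding primal_feasible_iff
proof (intro conjI \<pi>)
  have \<pi>s_probs: "\<pi>s n \<in> borel_probs" for n
    using \<pi>s by (simp add: primal_feasible_iff)
  show "(\<integral>\<^sup>+p. ennreal (c p) \<partial>\<pi>) \<le> ennreal \<delta>"
    using \<pi>s by (intro nn_integral_lsc_weak_limit_le[OF conv \<pi>s_probs \<pi> c _ \<open>0 \<le> \<delta>\<close>]) (simp add: primal_feasible_iff)
  have [measurable]: "fst \<in> borel_measurable (borel :: ('a \<times> 'a) measure)"
    by (intro borel_measurable_continuous_onI continuous_on_fst continuous_on_id)
  have fst_m: "fst \<in> borel_measurable M" if "M \<in> borel_probs" for M :: "('a \<times> 'a) measure"
    using borel_probsD(2)[OF that] by (simp cong: measurable_cong_sets)
  show "distr \<pi> borel fst = \<mu>"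
  proof (rule borel_probs_eqI[OF _ \<mu>])
    show "distr \<pi> borel fst \<in> borel_probs"
      using prob_space.prob_space_distr[OF borel_probsD(1)[OF \<pi>] fst_m[OF \<pi>]] by (simp add: borel_probs_def)
    fix g :: "'a \<Rightarrow> real"
    assume g: "continuous_on UNIV g" "bounded (range g)"
    then have [measurable]: "g \<in> borel_measurable borel"
      by (simp add: borel_measurable_continuous_onI)
    have marg: "integral\<^sup>L (distr M borel fst) g = (\<integral>p. g (fst p) \<partial>M)" if "M \<in> borel_probs" for M :: "('a \<times> 'a) measure"
      using fst_m[OF that] by (simp add: integral_distr)
    have "continuous_on UNIV (\<lambda>p. g (fst p))"
      by (rule continuous_on_compose2[OF g(1) continuous_on_fst[OF continuous_on_id]]) simp
    moreover have "bounded (range (\<lambda>p. g (fst p)))"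
      by (rule bounded_subset[OF g(2)]) auto
    ultimately have "(\<lambda>n. \<integral>p. g (fst p) \<partial>\<pi>s n) \<longlonglongrightarrow> (\<integral>p. g (fst p) \<partial>\<pi>)"
      using conv unfolding weakly_converges_def by blast
    moreover have "(\<integral>p. g (fst p) \<partial>\<pi>s n) = integral\<^sup>L \<mu> g" for n
      using marg[OF \<pi>s_probs[of n]] \<pi>s[of n] by (simp add: primal_feasible_iff)
    ultimately show "integral\<^sup>L (distr \<pi> borel fst) g = integral\<^sup>L \<mu> g"
      using marg[OF \<pi>] by (simp add: LIMSEQ_const_iff)
  qed
qed

text \<open>
  The setting of weak duality and of its consequences for near-optimal plans: \<open>g\<close> is a real Borel
  version of the dual function at the multiplier \<open>lam\<close>.
\<close>

locale dual_certificate =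
  fixes \<mu> :: "'a::{metric_space,second_countable_topology} measure"
    and c :: "'a \<times> 'a \<Rightarrow> real" and f g :: "'a \<Rightarrow> real" and \<delta> lam :: real
  assumes \<mu>: "\<mu> \<in> borel_probs"
    and \<delta>_nonneg: "0 \<le> \<delta>"
    and c_nonneg: "\<And>p. 0 \<le> c p"
    and c_diag: "\<And>x. c (x, x) = 0"
    and c_measurable [measurable]: "c \<in> borel_measurable borel"
    and f_measurable [measurable]: "f \<in> borel_measurable borel"
    and f_integrable: "integrable \<mu> f"
    and lam_nonneg: "0 \<le> lam"
    and g_integrable: "integrable \<mu> g"
    and dual_fun_eq: "AE x in \<mu>. dual_fun c f lam x = ereal (g x)"
begin

lemma fst_snd_measurable [measurable]:
  "fst \<in> borel_measurable (borel :: ('a \<times> 'a) measure)"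
  "snd \<in> borel_measurable (borel :: ('a \<times> 'a) measure)"
  by (intro borel_measurable_continuous_onI continuous_on_fst continuous_on_snd continuous_on_id)+

lemma g_measurable [measurable]: "g \<in> borel_measurable borel"
  using borel_measurable_integrable[OF g_integrable] borel_probsD(2)[OF \<mu>] by (simp cong: measurable_cong_sets)

text \<open>
  The pointwise gap in the dual constraint; complementary slackness is the statement that an
  optimal plan lives where it vanishes.
\<close>

definition slack :: "'a \<times> 'a \<Rightarrow> real" where
  "slack p = g (fst p) + lam * c p - f (snd p)"

lemma slack_measurable [measurable]: "slack \<in> borel_measurable borel"
  unfolding slack_def by measurable

text \<open>
  A transport from \<open>x\<close> to \<open>y\<close> with \<open>f y < f x\<close> is undone.  As staying put is free, this does not
  increase the cost; it does not decrease the gain either, and it turns a feasible plan into one supported where \<open>f x \<le> f y\<close>.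
\<close>

definition cancel_losses :: "'a \<times> 'a \<Rightarrow> 'a \<times> 'a" where
  "cancel_losses p = (fst p, if f (fst p) \<le> f (snd p) then snd p else fst p)"

lemma cancel_losses_measurable [measurable]: "cancel_losses \<in> borel_measurable borel"
  unfolding cancel_losses_def by measurable

lemma gain_cancel_losses: "f (snd (cancel_losses p)) = max (f (fst p)) (f (snd p))"
  by (auto simp: cancel_losses_def)

lemma cost_cancel_losses_le: "c (cancel_losses p) \<le> c p"
  using c_nonneg[of p] c_diag[of "fst p"] by (auto simp: cancel_losses_def)

context
  fixes \<pi>
  assumes \<pi>: "\<pi> \<in> primal_feasible c \<mu> \<delta>"
begin

lemma feasible_borel_probs: "\<pi> \<in> borel_probs" and feasible_marginal: "distr \<pi> borel fst = \<mu>"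
  and feasible_cost: "(\<integral>\<^sup>+p. ennreal (c p) \<partial>\<pi>) \<le> ennreal \<delta>"
  using \<pi> by (auto simp: primal_feasible_iff)

lemma feasible_sets [measurable_cong]: "sets \<pi> = sets borel"
  by (rule borel_probsD(2)[OF feasible_borel_probs])

lemma AE_dual_fun_eq: "AE p in \<pi>. dual_fun c f lam (fst p) = ereal (g (fst p))"
proof (rule AE_distrD[where M'=borel and f=fst and P="\<lambda>x. dual_fun c f lam x = ereal (g x)"])
  show "fst \<in> borel_measurable \<pi>"
    by measurable
  show "AE x in distr \<pi> borel fst. dual_fun c f lam x = ereal (g x)"
    unfolding feasible_marginal by (rule dual_fun_eq)
qed

lemma AE_slack_nonneg: "AE p in \<pi>. 0 \<le> slack p"
  using AE_dual_fun_eq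
proof eventually_elim
  case (elim p)
  have "ereal (f (snd p) - lam * c (fst p, snd p)) \<le> dual_fun c f lam (fst p)"
    unfolding dual_fun_def by (rule SUP_upper) simp
  then show ?case
    using elim by (simp add: slack_def)
qed

lemma cost_integrable: "integrable \<pi> c" and cost_integral_le: "integral\<^sup>L \<pi> c \<le> \<delta>"
proof -
  show i: "integrable \<pi> c"
    using feasible_cost c_nonneg by (intro integrableI_nonneg) (auto simp: less_top[symmetric] top_unique)
  have "ennreal (integral\<^sup>L \<pi> c) \<le> ennreal \<delta>"
    using feasible_cost nn_integral_eq_integral[OF i] c_nonneg by simp
  then show "integral\<^sup>L \<pi> c \<le> \<delta>"
    using \<delta>_nonneg by simp
qed

lemma integrable_first_marginal:
  fixes u :: "'a \<Rightarrow> real"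
  assumes "integrable \<mu> u"
  shows "integrable \<pi> (\<lambda>p. u (fst p))" "(\<integral>p. u (fst p) \<partial>\<pi>) = integral\<^sup>L \<mu> u"
proof -
  have u: "u \<in> borel_measurable borel"
    using borel_measurable_integrable[OF assms] borel_probsD(2)[OF \<mu>] by (simp cong: measurable_cong_sets)
  have "integrable (distr \<pi> borel fst) u"
    using assms by (simp add: feasible_marginal)
  then show "integrable \<pi> (\<lambda>p. u (fst p))"
    by (intro integrable_distr[where M'=borel and T=fst and f=u]) measurable
  show "(\<integral>p. u (fst p) \<partial>\<pi>) = integral\<^sup>L \<mu> u"
    unfolding feasible_marginal[symmetric] by (subst integral_distr) (use u in auto)
qed

text \<open>
  The dual constraint dominates the gain by an integrable function.  Hence only the negative part
  of the gain can have infinite integral, and the objective is never of the form \<open>\<infinity> - \<infinity>\<close>.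
\<close>

lemma nn_integral_gain_finite: "(\<integral>\<^sup>+p. ennreal (f (snd p)) \<partial>\<pi>) < \<infinity>"
proof -
  have i: "integrable \<pi> (\<lambda>p. g (fst p) + lam * c p)"
    using integrable_first_marginal(1)[OF g_integrable] cost_integrable by simp
  have "(\<integral>\<^sup>+p. ennreal (f (snd p)) \<partial>\<pi>) \<le> (\<integral>\<^sup>+p. ennreal (g (fst p) + lam * c p) \<partial>\<pi>)"
    by (rule nn_integral_mono_AE, use AE_slack_nonneg in eventually_elim) (simp add: slack_def ennreal_leI)
  also have "\<dots> < \<infinity>"
    using i by (auto simp: real_integrable_def less_top)
  finally show ?thesis .
qed

lemma integrable_gain_iff: "integrable \<pi> (\<lambda>p. f (snd p)) \<longleftrightarrow> (\<integral>\<^sup>+p. ennreal (- f (snd p)) \<partial>\<pi>) < \<infinity>"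
  using nn_integral_gain_finite by (simp add: real_integrable_def less_top)

lemma primal_obj_eq_integral:
  "integrable \<pi> (\<lambda>p. f (snd p)) \<Longrightarrow> primal_obj f \<pi> = ereal (\<integral>p. f (snd p) \<partial>\<pi>)"
  using ext_integral_ereal[of \<pi> "\<lambda>p. f (snd p)"] by (simp add: primal_obj_def case_prod_beta')

lemma primal_obj_eq_minus_infinity:
  assumes "\<not> integrable \<pi> (\<lambda>p. f (snd p))"
  shows "primal_obj f \<pi> = - \<infinity>"
proof -
  have "(\<integral>\<^sup>+p. ennreal (- f (snd p)) \<partial>\<pi>) = \<infinity>"
    using assms integrable_gain_iff by (simp add: less_top[symmetric])
  moreover obtain b where "(\<integral>\<^sup>+p. ennreal (f (snd p)) \<partial>\<pi>) = ennreal b" "0 \<le> b"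
    using nn_integral_gain_finite by (cases "\<integral>\<^sup>+p. ennreal (f (snd p)) \<partial>\<pi>") auto
  ultimately show ?thesis
    by (simp add: primal_obj_def ext_integral_def nn_integral_completion case_prod_beta')
qed

text \<open>
  Weak duality in quantitative form: the mean slack is bounded by the distance of the plan from the
  dual value.
\<close>

lemma slack_integral:
  assumes "integrable \<pi> (\<lambda>p. f (snd p))"
  shows "integrable \<pi> slack" "integral\<^sup>L \<pi> slack \<le> lam * \<delta> + integral\<^sup>L \<mu> g - (\<integral>p. f (snd p) \<partial>\<pi>)"
proof -
  note i = integrable_first_marginal[OF g_integrable] cost_integrable assms
  show "integrable \<pi> slack"
    unfolding slack_def[abs_def] using i by simp
  have "integral\<^sup>L \<pi> slack = integral\<^sup>L \<mu> g + lam * integral\<^sup>L \<pi> c - (\<integral>p. f (snd p) \<partial>\<pi>)"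
    unfolding slack_def[abs_def] using i by simp
  then show "integral\<^sup>L \<pi> slack \<le> lam * \<delta> + integral\<^sup>L \<mu> g - (\<integral>p. f (snd p) \<partial>\<pi>)"
    using mult_left_mono[OF cost_integral_le lam_nonneg] by simp
qed

lemma measure_slack_le:
  assumes "integrable \<pi> (\<lambda>p. f (snd p))" "0 < \<gamma>"
  shows "measure \<pi> {p. \<gamma> \<le> slack p} \<le> (lam * \<delta> + integral\<^sup>L \<mu> g - (\<integral>p. f (snd p) \<partial>\<pi>)) / \<gamma>"
proof -
  have "measure \<pi> {p \<in> space \<pi>. \<gamma> \<le> slack p} \<le> integral\<^sup>L \<pi> slack / \<gamma>"
    using slack_integral(1)[OF assms(1)] AE_slack_nonneg assms(2)
    by (intro integral_Markov_inequality_measure[where A="{}"]) auto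
  also have "\<dots> \<le> (lam * \<delta> + integral\<^sup>L \<mu> g - (\<integral>p. f (snd p) \<partial>\<pi>)) / \<gamma>"
    using slack_integral(2)[OF assms(1)] assms(2) by (intro divide_right_mono) auto
  finally show ?thesis
    using borel_probsD(3)[OF feasible_borel_probs] by simp
qed

text \<open>
  By Markov's inequality a near-optimal plan puts little mass on slack \<open>\<gamma>\<close> or more, while its first
  coordinate lies in \<open>K\<close> with probability \<open>\<mu> K\<close>.  Points of \<open>K\<close> with smaller slack are in \<open>H\<close>.
\<close>

lemma measure_near_optimal_le:
  assumes int: "integrable \<pi> (\<lambda>p. f (snd p))" and "0 < \<gamma>" and K: "K \<in> sets borel" and H: "H \<in> sets borel"
    and sub: "{(x, y). x \<in> K \<and> ereal (f y - lam * c (x, y)) \<ge> dual_fun c f lam x - ereal \<gamma>} \<subseteq> H"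
  shows "measure \<mu> K - (lam * \<delta> + integral\<^sup>L \<mu> g - (\<integral>p. f (snd p) \<partial>\<pi>)) / \<gamma> \<le> measure \<pi> H"
proof -
  interpret prob_space \<pi> by (rule borel_probsD(1)[OF feasible_borel_probs])
  note [measurable] = K H
  have "measure \<mu> K = prob (fst -` K \<inter> space \<pi>)"
    unfolding feasible_marginal[symmetric] by (rule measure_distr) measurable
  also have "\<dots> \<le> prob (H \<union> {p. \<gamma> \<le> slack p})"
  proof (rule finite_measure_mono_AE)
    show "AE p in \<pi>. p \<in> fst -` K \<inter> space \<pi> \<longrightarrow> p \<in> H \<union> {p. \<gamma> \<le> slack p}"
      using AE_dual_fun_eq
    proof eventually_elim
      case (elim p)
      have "p \<in> H" if "fst p \<in> K" "slack p < \<gamma>"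
      proof (rule subsetD[OF sub])
        have "dual_fun c f lam (fst p) - ereal \<gamma> \<le> ereal (f (snd p) - lam * c (fst p, snd p))"
          using that(2) unfolding elim by (simp add: slack_def)
        then show "p \<in> {(x, y). x \<in> K \<and> ereal (f y - lam * c (x, y)) \<ge> dual_fun c f lam x - ereal \<gamma>}"
          using that(1) by (simp add: case_prod_beta)
      qed
      then show ?case
        by (auto simp: not_le[symmetric])
    qed
  qed measurable
  also have "\<dots> \<le> prob H + prob {p. \<gamma> \<le> slack p}"
    by (rule measure_Un_le) measurable
  finally show ?thesis
    using measure_slack_le[OF int \<open>0 < \<gamma>\<close>] by simp
qed

lemma distr_cancel_losses_feasible': "distr \<pi> borel cancel_losses \<in> primal_feasible' c f \<mu> \<delta>"
proof -
  interpret prob_space \<pi> by (rule borel_probsD(1)[OF feasible_borel_probs])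
  have probs: "distr \<pi> borel cancel_losses \<in> borel_probs"
    by (simp add: borel_probs_def prob_space_distr)
  have "distr (distr \<pi> borel cancel_losses) borel fst = distr \<pi> borel (fst \<circ> cancel_losses)"
    by (rule distr_distr) measurable
  then have marg: "distr (distr \<pi> borel cancel_losses) borel fst = \<mu>"
    by (simp add: comp_def cancel_losses_def feasible_marginal)
  have "(\<integral>\<^sup>+p. ennreal (c p) \<partial>distr \<pi> borel cancel_losses) = (\<integral>\<^sup>+p. ennreal (c (cancel_losses p)) \<partial>\<pi>)"
    by (rule nn_integral_distr) measurable
  also have "\<dots> \<le> (\<integral>\<^sup>+p. ennreal (c p) \<partial>\<pi>)"
    by (intro nn_integral_mono ennreal_leI cost_cancel_losses_le)
  finally have cost: "(\<integral>\<^sup>+p. ennreal (c p) \<partial>distr \<pi> borel cancel_losses) \<le> ennreal \<delta>"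
    using feasible_cost by simp
  have "{(x, y). f x \<le> f y} = {p. f (fst p) \<le> f (snd p)}"
    by auto
  moreover have "emeasure (distr \<pi> borel cancel_losses) {p. f (fst p) \<le> f (snd p)} = emeasure \<pi> (space \<pi>)"
    by (subst emeasure_distr) (simp_all add: gain_cancel_losses borel_probsD(3)[OF feasible_borel_probs], simp add: cancel_losses_def)
  ultimately show ?thesis
    using probs marg cost by (simp add: primal_feasible'_def primal_feasible_iff emeasure_space_1)
qed

lemma gain_distr_cancel_losses:
  assumes int: "integrable \<pi> (\<lambda>p. f (snd p))"
  shows "integrable (distr \<pi> borel cancel_losses) (\<lambda>p. f (snd p))"
    "(\<integral>p. f (snd p) \<partial>\<pi>) \<le> (\<integral>p. f (snd p) \<partial>distr \<pi> borel cancel_losses)"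
proof -
  have i: "integrable \<pi> (\<lambda>p. max (f (fst p)) (f (snd p)))"
    using integrable_first_marginal(1)[OF f_integrable] int by (rule integrable_max)
  show "integrable (distr \<pi> borel cancel_losses) (\<lambda>p. f (snd p))"
    by (subst integrable_distr_eq) (use i in \<open>auto simp: gain_cancel_losses\<close>)
  have "(\<integral>p. f (snd p) \<partial>\<pi>) \<le> (\<integral>p. max (f (fst p)) (f (snd p)) \<partial>\<pi>)"
    using int i by (rule integral_mono) simp
  also have "\<dots> = (\<integral>p. f (snd p) \<partial>distr \<pi> borel cancel_losses)"
    by (subst integral_distr) (auto simp: gain_cancel_losses)
  finally show "(\<integral>p. f (snd p) \<partial>\<pi>) \<le> (\<integral>p. f (snd p) \<partial>distr \<pi> borel cancel_losses)" .
qed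

end

section \<open>Existence of a primal optimizer\<close>

text \<open>
  The compactness condition yields the compact set \<open>H\<close>, of mass at least \<open>1 - \<epsilon>\<close> as soon as the plan
  is within \<open>\<epsilon> * \<gamma> / 2\<close> of optimality.
\<close>

lemma tight_near_optimal:
  assumes \<pi>: "\<And>n. \<pi>s n \<in> primal_feasible c \<mu> \<delta>"
    and int: "\<And>n. integrable (\<pi>s n) (\<lambda>p. f (snd p))"
    and opt: "(\<lambda>n. \<integral>p. f (snd p) \<partial>\<pi>s n) \<longlonglongrightarrow> lam * \<delta> + integral\<^sup>L \<mu> g"
    and compact: "P_compactness c f \<mu> lam" and "0 < \<epsilon>"
  shows "\<exists>H. compact H \<and> (\<forall>\<^sub>F n in sequentially. 1 - \<epsilon> \<le> measure (\<pi>s n) H)"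
proof -
  let ?J = "lam * \<delta> + integral\<^sup>L \<mu> g"
  obtain K \<gamma> where K: "compact K" "measure \<mu> K > 1 - \<epsilon> / 2" and \<gamma>: "0 < \<gamma>"
    and H: "compact (closure {(x, y). x \<in> K \<and> ereal (f y - lam * c (x, y)) \<ge> dual_fun c f lam x - ereal \<gamma>})"
      (is "compact (closure ?\<Gamma>)")
    using compact half_gt_zero[OF \<open>0 < \<epsilon>\<close>] unfolding P_compactness_def by blast
  have "\<forall>\<^sub>F n in sequentially. ?J - \<epsilon> / 2 * \<gamma> < (\<integral>p. f (snd p) \<partial>\<pi>s n)"
    using \<gamma> \<open>0 < \<epsilon>\<close> by (intro order_tendstoD(1)[OF opt]) simp
  then have "\<forall>\<^sub>F n in sequentially. 1 - \<epsilon> \<le> measure (\<pi>s n) (closure ?\<Gamma>)"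
  proof eventually_elim
    case (elim n)
    have "(?J - (\<integral>p. f (snd p) \<partial>\<pi>s n)) / \<gamma> \<le> \<epsilon> / 2"
      using elim \<gamma> by (simp add: pos_divide_le_eq)
    moreover have "measure \<mu> K - (?J - (\<integral>p. f (snd p) \<partial>\<pi>s n)) / \<gamma> \<le> measure (\<pi>s n) (closure ?\<Gamma>)"
      using K(1) H by (intro measure_near_optimal_le \<pi> int \<gamma> closure_subset) (auto intro: borel_compact)
    ultimately show ?case
      using K(2) by linarith
  qed
  then show ?thesis
    using H by blast
qed

text \<open>
  Almost maximal plans exist by definition of the supremum, and cancelling the transports that lose
  gain makes them members of the smaller set to which the upper semicontinuity condition applies.
\<close>

lemma maximizing_sequence:
  assumes val: "primal_value c f \<mu> \<delta> = ereal v"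
  obtains \<pi>s where "\<And>n. \<pi>s n \<in> primal_feasible' c f \<mu> \<delta>"
    "\<And>n. integrable (\<pi>s n) (\<lambda>p. f (snd p))"
    "(\<lambda>n. \<integral>p. f (snd p) \<partial>\<pi>s n) \<longlonglongrightarrow> v"
proof -
  have adm: "{\<pi> \<in> primal_feasible c \<mu> \<delta>. (\<integral>\<^sup>+(x, y). ennreal (max (- f y) 0) \<partial>\<pi>) < \<infinity>} =
      {\<pi> \<in> primal_feasible c \<mu> \<delta>. integrable \<pi> (\<lambda>p. f (snd p))}" (is "?A = ?B")
    using integrable_gain_iff by (auto simp: case_prod_beta' max.commute ennreal_max_0)
  have le: "(\<integral>p. f (snd p) \<partial>\<pi>) \<le> v" if "\<pi> \<in> ?B" for \<pi>
  proof -
    have "primal_obj f \<pi> \<le> primal_value c f \<mu> \<delta>"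
      unfolding primal_value_def adm using that by (intro Sup_upper imageI)
    then show ?thesis
      using that val by (simp add: primal_obj_eq_integral)
  qed
  have "\<exists>\<pi>. \<pi> \<in> primal_feasible' c f \<mu> \<delta> \<and> integrable \<pi> (\<lambda>p. f (snd p)) \<and>
      v - 1 / real (Suc n) < (\<integral>p. f (snd p) \<partial>\<pi>)" for n
  proof -
    have "ereal (v - 1 / real (Suc n)) < primal_value c f \<mu> \<delta>"
      by (simp add: val)
    then obtain \<pi> where \<pi>: "\<pi> \<in> primal_feasible c \<mu> \<delta>" "integrable \<pi> (\<lambda>p. f (snd p))"
      and "ereal (v - 1 / real (Suc n)) < primal_obj f \<pi>"
      unfolding primal_value_def adm less_Sup_iff by blast
    then have "v - 1 / real (Suc n) < (\<integral>p. f (snd p) \<partial>\<pi>)"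
      by (simp add: primal_obj_eq_integral)
    then show ?thesis
      using distr_cancel_losses_feasible'[OF \<pi>(1)] gain_distr_cancel_losses[OF \<pi>] by force
  qed
  then obtain \<pi>s where \<pi>s: "\<And>n. \<pi>s n \<in> primal_feasible' c f \<mu> \<delta>"
    "\<And>n. integrable (\<pi>s n) (\<lambda>p. f (snd p))"
    "\<And>n. v - 1 / real (Suc n) < (\<integral>p. f (snd p) \<partial>\<pi>s n)"
    by metis
  have "(\<lambda>n. \<integral>p. f (snd p) \<partial>\<pi>s n) \<longlonglongrightarrow> v"
  proof (rule tendsto_sandwich)
    show "(\<lambda>n. v - 1 / real (Suc n)) \<longlonglongrightarrow> v"
      using tendsto_diff[OF tendsto_const LIMSEQ_inverse_real_of_nat] by (simp add: inverse_eq_divide)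
    show "(\<lambda>n. v) \<longlonglongrightarrow> v"
      by simp
    show "\<forall>\<^sub>F n in sequentially. v - 1 / real (Suc n) \<le> (\<integral>p. f (snd p) \<partial>\<pi>s n)"
      using \<pi>s(3) by (intro always_eventually allI less_imp_le)
    show "\<forall>\<^sub>F n in sequentially. (\<integral>p. f (snd p) \<partial>\<pi>s n) \<le> v"
      using le \<pi>s(1,2) by (auto intro!: always_eventually simp: primal_feasible'_def)
  qed
  with \<pi>s(1,2) that show ?thesis
    by blast
qed

text \<open>
  The limit is admissible for the supremum because upper semicontinuity bounds its objective from
  below by the finite optimal value, which forces its gain to be integrable; weak duality gives the
  reverse inequality.
\<close>

lemma primal_optimizer_exists:
  assumes lsc: "lower_semicontinuous c"
    and strong_duality: "primal_value c f \<mu> \<delta> = ereal (lam * \<delta> + integral\<^sup>L \<mu> g)"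
    and compact: "P_compactness c f \<mu> lam" and usc: "P_usc c f \<mu> \<delta>"
  shows "\<exists>\<pi>\<in>primal_feasible c \<mu> \<delta>. primal_obj f \<pi> = primal_value c f \<mu> \<delta>"
proof -
  let ?J = "lam * \<delta> + integral\<^sup>L \<mu> g"
  obtain \<pi>s where \<pi>s': "\<And>n. \<pi>s n \<in> primal_feasible' c f \<mu> \<delta>"
    and int: "\<And>n. integrable (\<pi>s n) (\<lambda>p. f (snd p))"
    and opt: "(\<lambda>n. \<integral>p. f (snd p) \<partial>\<pi>s n) \<longlonglongrightarrow> ?J"
    using maximizing_sequence[OF strong_duality] by blast
  have \<pi>s: "\<pi>s n \<in> primal_feasible c \<mu> \<delta>" for n
    using \<pi>s' by (simp add: primal_feasible'_def)
  have "\<pi>s n \<in> borel_probs" for n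
    using \<pi>s by (simp add: primal_feasible_iff)
  then obtain r \<pi> where r: "strict_mono r" and \<pi>_probs: "\<pi> \<in> borel_probs"
    and conv: "weakly_converges (\<pi>s \<circ> r) \<pi>"
    using tight_imp_weakly_convergent_subsequence[of \<pi>s] tight_near_optimal[OF \<pi>s int opt compact] by blast
  have \<pi>: "\<pi> \<in> primal_feasible c \<mu> \<delta>"
    using \<pi>s c_nonneg lsc \<delta>_nonneg by (intro primal_feasible_weak_limit[OF conv \<pi>_probs _ \<mu>]) auto
  have "(\<lambda>n. primal_obj f ((\<pi>s \<circ> r) n)) \<longlonglongrightarrow> ereal ?J"
    using LIMSEQ_subseq_LIMSEQ[OF opt r] by (simp add: primal_obj_eq_integral[OF \<pi>s int] comp_def)
  then have "limsup (\<lambda>n. primal_obj f ((\<pi>s \<circ> r) n)) = ereal ?J"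
    by (intro lim_imp_Limsup) auto
  moreover have "limsup (\<lambda>n. primal_obj f ((\<pi>s \<circ> r) n)) \<le> primal_obj f \<pi>"
    using usc \<pi> \<pi>s' conv unfolding P_usc_def by (metis comp_apply)
  ultimately have ge: "ereal ?J \<le> primal_obj f \<pi>"
    by simp
  then have i: "integrable \<pi> (\<lambda>p. f (snd p))"
    using primal_obj_eq_minus_infinity[OF \<pi>] by force
  have "0 \<le> integral\<^sup>L \<pi> slack"
    using AE_slack_nonneg[OF \<pi>] by (rule integral_nonneg_AE)
  then have "primal_obj f \<pi> \<le> ereal ?J"
    using slack_integral(2)[OF \<pi> i] by (simp add: primal_obj_eq_integral[OF \<pi> i])
  with ge \<pi> strong_duality show ?thesis
    by (metis order.antisym)
qed

end

theorem proposition9: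
  fixes \<mu> :: "'a::polish_space measure"
    and c :: "'a \<times> 'a \<Rightarrow> real"
    and f :: "'a \<Rightarrow> real"
    and \<delta> lam :: real
  assumes "\<mu> \<in> borel_probs"
    and "\<delta> > 0"
    and "\<And>x y. c (x, y) \<ge> 0"
    and "lower_semicontinuous c"
    and "\<And>x y. c (x, y) = 0 \<longleftrightarrow> x = y"
    and "upper_semicontinuous f"
    and "integrable \<mu> f"
    and "(lam, dual_fun c f lam) \<in> dual_feasible c f"
    and "primal_value c f \<mu> \<delta> = dual_value c f \<mu> \<delta>"
    and "dual_value c f \<mu> \<delta> = dual_obj \<mu> \<delta> (lam, dual_fun c f lam)"
    and "dual_obj \<mu> \<delta> (lam, dual_fun c f lam) < \<infinity>"
    and "P_compactness c f \<mu> lam"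
    and "P_usc c f \<mu> \<delta>"
  shows "\<exists>\<pi>\<in>primal_feasible c \<mu> \<delta>.
           primal_obj f \<pi> = primal_value c f \<mu> \<delta> \<and>
           primal_value c f \<mu> \<delta> = dual_value c f \<mu> \<delta> \<and>
           dual_value c f \<mu> \<delta> = dual_obj \<mu> \<delta> (lam, dual_fun c f lam)"
proof -
  have c_nonneg: "0 \<le> c p" for p
    using assms(3) by (cases p) simp
  have dual: "0 \<le> lam" "dual_fun c f lam \<in> borel_measurable universal_algebra"
    using assms(8) by (auto simp: dual_feasible_def)
  have ge: "ereal (f x) \<le> dual_fun c f lam x" for x
    using assms(8) assms(5)[of x x] by (auto simp: dual_feasible_def dest!: spec[of _ x])
  have "ext_integral \<mu> (dual_fun c f lam) < \<infinity>"
    using assms(11) by (cases "ext_integral \<mu> (dual_fun c f lam)") (auto simp: dual_obj_def)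
  then obtain g where g: "integrable \<mu> g" "AE x in \<mu>. dual_fun c f lam x = ereal (g x)"
    using borel_version_of_universally_measurable[OF assms(1) dual(2) assms(7) ge] by blast
  interpret dual_certificate \<mu> c f g \<delta> lam
    using assms c_nonneg dual(1) g
    by unfold_locales (auto intro: borel_measurable_lower_semicontinuous borel_measurable_upper_semicontinuous)
  have "primal_value c f \<mu> \<delta> = ereal (lam * \<delta> + integral\<^sup>L \<mu> g)"
    using ext_integral_cong_AE[OF g(2)] ext_integral_ereal[OF g(1)] by (simp add: assms(9,10) dual_obj_def)
  then show ?thesis
    using primal_optimizer_exists[OF assms(4) _ assms(12,13)] assms(9,10) by blast
qed

end
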